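(* In the toy model (see context), the components $z^+_0,\dots,z^+_{L-1}$ of the vector of rescaled well coordinates of the threshold configuration, $z^+_i=\Delta m^+_i+\Delta\alpha_i$, form an exchangeable random vector (with respect to the randomness of $\vec\alpha$).
   Context: Toy model: $L$ sites with periodic boundary conditions (indices mod $L$); disorder $\alpha_0,\dots,\alpha_{L-1}$ i.i.d. uniform on $(-\tfrac12,\tfrac12)$, extended periodically; $\Delta x_i=x_{i-1}-2x_i+x_{i+1}$ (periodic). A configuration is $\vec m\in\mathbb Z^L$ with rescaled well coordinates $z_i=\Delta m_i+\Delta\alpha_i$. The threshold configuration $\vec m^+$ is a minimizer of $\max_i z_i$ over $\vec m\in\mathbb Z^L$; it is a.s. unique up to adding a common integer to all components, so $\vec z^+$ is a.s. well defined. *)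

theory Defs
  imports "HOL-Probability.Probability"
begin

text \<open>Sites are indexed by naturals; index i is read modulo L (periodic boundary).\<close>

definition lap :: "nat \<Rightarrow> (nat \<Rightarrow> 'a::comm_ring_1) \<Rightarrow> nat \<Rightarrow> 'a" where
  "lap L x i = x ((i + L - 1) mod L) - 2 * x (i mod L) + x ((i + 1) mod L)"

definition zcoord :: "nat \<Rightarrow> (nat \<Rightarrow> real) \<Rightarrow> (nat \<Rightarrow> int) \<Rightarrow> nat \<Rightarrow> real" where
  "zcoord L \<alpha> m i = real_of_int (lap L m i) + lap L \<alpha> i"

definition maxz :: "nat \<Rightarrow> (nat \<Rightarrow> real) \<Rightarrow> (nat \<Rightarrow> int) \<Rightarrow> real" where
  "maxz L \<alpha> m = Max ((zcoord L \<alpha> m) ` {..<L})"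

definition is_threshold :: "nat \<Rightarrow> (nat \<Rightarrow> real) \<Rightarrow> (nat \<Rightarrow> int) \<Rightarrow> bool" where
  "is_threshold L \<alpha> m \<longleftrightarrow> (\<forall>m'. maxz L \<alpha> m \<le> maxz L \<alpha> m')"

text \<open>The vector z^+ (components 0..L-1), using some threshold configuration
  (a.s. unique up to a common integer shift, which does not change z).\<close>
definition threshold_z :: "nat \<Rightarrow> (nat \<Rightarrow> real) \<Rightarrow> nat \<Rightarrow> real" where
  "threshold_z L \<alpha> = (\<lambda>i\<in>{..<L}. zcoord L \<alpha> (SOME m. is_threshold L \<alpha> m) i)"

definition disorder :: "nat \<Rightarrow> (nat \<Rightarrow> real) measure" where
  "disorder L = completion (PiM {..<L} (\<lambda>_. uniform_measure lborel {-1/2<..<1/2}))"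

definition vec_space :: "nat \<Rightarrow> (nat \<Rightarrow> real) measure" where
  "vec_space L = PiM {..<L} (\<lambda>_. borel)"

end

theory Submission
  imports Defs
begin

text \<open>Write \<open>z = \<Delta>\<alpha>\<close>. The image of the integer vectors under \<open>\<Delta>\<close> is the lattice of all integer
  vectors \<open>k\<close> with \<open>\<Sum> k i = 0\<close> and \<open>L\<close> dividing \<open>\<Sum> i k i\<close>; it has index \<open>L\<close> in the lattice \<open>A\<close>
  of all sum-zero integer vectors. If no two \<open>z i\<close> agree modulo 1, there is a unique integer vector
  \<open>k\<close> of sum 1 such that the entries of \<open>w = z + k\<close> have spread less than 1, and
  \<open>z\<^sup>+ = w - e\<^sub>J\<close>, where \<open>J\<close> is \<open>\<Sum> i k i\<close> modulo \<open>L\<close>. Now \<open>w\<close> depends only on \<open>z\<close> modulo \<open>A\<close> and does so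
  equivariantly under permutations. The law of \<open>z\<close> modulo the image lattice is invariant under all sum-zero
  translations. Translations by \<open>A\<close> show that \<open>J\<close> is uniform given \<open>w\<close>, and uniqueness of Haar
  measure shows that the law of \<open>z\<close> modulo \<open>A\<close> is exchangeable.\<close>

subsection \<open>The image of the periodic Laplacian\<close>

lemma pred_succ_mod: "i < L \<Longrightarrow> ((i + 1) mod L + L - 1) mod L = i" for i L :: nat
  by (cases "i + 1 = L") auto

lemma succ_pred_mod: "((i + L - 1) mod L + 1) mod L = i" if "i < L" for i L :: nat
proof (cases i)
  case 0
  then show ?thesis using that by auto
next
  case (Suc n)
  then have "i + L - 1 = n + L" by simp
  then show ?thesis using that Suc by simp
qed

lemma sum_cyclic_shift:
  fixes f :: "nat \<Rightarrow> 'a::comm_monoid_add"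
  assumes "L \<ge> 1"
  shows "(\<Sum>i<L. f ((i + 1) mod L)) = (\<Sum>i<L. f i)"
    and "(\<Sum>i<L. f ((i + L - 1) mod L)) = (\<Sum>i<L. f i)"
proof -
  show "(\<Sum>i<L. f ((i + 1) mod L)) = (\<Sum>i<L. f i)"
    by (rule sum.reindex_bij_witness[where i="\<lambda>i. (i + L - 1) mod L" and j="\<lambda>i. (i + 1) mod L"])
      (use assms pred_succ_mod succ_pred_mod in auto)
  show "(\<Sum>i<L. f ((i + L - 1) mod L)) = (\<Sum>i<L. f i)"
    by (rule sum.reindex_bij_witness[where j="\<lambda>i. (i + L - 1) mod L" and i="\<lambda>i. (i + 1) mod L"])
      (use assms pred_succ_mod succ_pred_mod in auto)
qed

lemma sum_lap:
  assumes "L \<ge> 1"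
  shows "(\<Sum>i<L. lap L x i) = 0"
proof -
  have "(\<Sum>i<L. x (i mod L)) = (\<Sum>i<L. x i)"
    by (rule sum.cong) auto
  then show ?thesis
    using sum_cyclic_shift[OF assms, of x]
    by (simp add: lap_def sum.distrib sum_subtractf flip: sum_distrib_left)
qed

text \<open>Summation by parts moves the Laplacian onto the weights: the periodic second difference
  of the site index is a multiple of L at every site, the only jump being at the
  wrap-around.\<close>

lemma dvd_sum_index_lap:
  fixes m :: "nat \<Rightarrow> int"
  assumes "L \<ge> 1"
  shows "int L dvd (\<Sum>i<L. int i * lap L m i)"
proof -
  have A: "(\<Sum>i<L. int i * m ((i + 1) mod L)) = (\<Sum>i<L. int ((i + L - 1) mod L) * m i)"
  proof -
    have "(\<Sum>i<L. int i * m ((i + 1) mod L)) =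
        (\<Sum>i<L. (\<lambda>j. int ((j + L - 1) mod L) * m j) ((i + 1) mod L))"
    proof (rule sum.cong)
      fix i assume "i \<in> {..<L}"
      then have "((i + 1) mod L + L - 1) mod L = i"
        by (intro pred_succ_mod) simp
      then show "int i * m ((i + 1) mod L) =
          (\<lambda>j. int ((j + L - 1) mod L) * m j) ((i + 1) mod L)"
        by (simp del: One_nat_def)
    qed auto
    also have "\<dots> = (\<Sum>i<L. int ((i + L - 1) mod L) * m i)"
      by (rule sum_cyclic_shift(1)[OF assms])
    finally show ?thesis .
  qed
  have B: "(\<Sum>i<L. int i * m ((i + L - 1) mod L)) = (\<Sum>i<L. int ((i + 1) mod L) * m i)"
  proof -
    have "(\<Sum>i<L. int i * m ((i + L - 1) mod L)) =
        (\<Sum>i<L. (\<lambda>j. int ((j + 1) mod L) * m j) ((i + L - 1) mod L))"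
    proof (rule sum.cong)
      fix i assume "i \<in> {..<L}"
      then have "((i + L - 1) mod L + 1) mod L = i"
        by (intro succ_pred_mod) simp
      then show "int i * m ((i + L - 1) mod L) =
          (\<lambda>j. int ((j + 1) mod L) * m j) ((i + L - 1) mod L)"
        by (simp del: One_nat_def)
    qed auto
    also have "\<dots> = (\<Sum>i<L. int ((i + 1) mod L) * m i)"
      by (rule sum_cyclic_shift(2)[OF assms])
    finally show ?thesis .
  qed
  have "(\<Sum>i<L. int i * lap L m i) =
      (\<Sum>i<L. int i * m ((i + L - 1) mod L)) - (\<Sum>i<L. 2 * int i * m i)
      + (\<Sum>i<L. int i * m ((i + 1) mod L))"
    unfolding sum.distrib[symmetric] sum_subtractf[symmetric]
    by (rule sum.cong) (auto simp: lap_def algebra_simps)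
  also have "\<dots> = (\<Sum>i<L. (int ((i + 1) mod L) - 2 * int i + int ((i + L - 1) mod L)) * m i)"
    unfolding A B sum.distrib[symmetric] sum_subtractf[symmetric]
    by (rule sum.cong) (auto simp: algebra_simps)
  also have "int L dvd \<dots>"
  proof (rule dvd_sum, rule dvd_mult2)
    fix i
    have "int L dvd int ((i + 1) mod L) - int (i + 1)"
      "int L dvd int ((i + L - 1) mod L) - int (i + L - 1)"
      by (simp_all only: of_nat_mod mod_eq_dvd_iff[symmetric] mod_mod_trivial)
    \<comment> \<open>The extra \<open>int L\<close> cancels the L in i + L - 1, which is there to
      keep the predecessor index a natural number.\<close>
    then have "int L dvd (int ((i + 1) mod L) - int (i + 1))
        + (int ((i + L - 1) mod L) - int (i + L - 1)) + int L"
      by (intro dvd_add dvd_refl)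
    then show "int L dvd int ((i + 1) mod L) - 2 * int i + int ((i + L - 1) mod L)"
      using assms by (simp add: of_nat_diff algebra_simps)
  qed
  finally show ?thesis .
qed

text \<open>The Laplacian is inverted by summing twice; \<open>s\<close> is the initial slope for which the
  twice summed sequence closes up after one period.\<close>

lemma lap_surj:
  fixes y :: "nat \<Rightarrow> 'a::comm_ring_1"
  assumes L: "L \<ge> 1" and y: "(\<Sum>i<L. y i) = 0"
    and s: "of_nat L * s = (\<Sum>i<L. of_nat i * y i)"
  shows "\<exists>x. \<forall>i<L. lap L x i = y i"
proof -
  define x where "x j = of_nat j * s + (\<Sum>i<j. \<Sum>l\<le>i. y l)" for j
  have step: "x (Suc j) = x j + s + (\<Sum>l\<le>j. y l)" for j
    by (simp add: x_def algebra_simps)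
  \<comment> \<open>Exchange the two summations: y i is counted once for each outer index from i to
    n - 1. At n = L this gives minus the weighted sum, which the slope term cancels, so x closes
    up.\<close>
  have dbl: "(\<Sum>i<n. \<Sum>l\<le>i. y l) = (\<Sum>i<n. (of_nat n - of_nat i) * y i)" for n
  proof (induction n)
    case (Suc n)
    have "(\<Sum>i<Suc n. (of_nat (Suc n) - of_nat i) * y i) =
       (\<Sum>i<n. (of_nat n - of_nat i) * y i + y i) + y n"
      by (simp add: algebra_simps)
    then show ?case
      by (simp add: Suc sum.distrib add.assoc flip: lessThan_Suc_atMost[of n])
  qed simp
  have xL: "x L = 0"
    using y s by (simp add: x_def dbl left_diff_distrib sum_subtractf flip: sum_distrib_left)
  have x0: "x 0 = 0" by (simp add: x_def)
  have xmod: "x (Suc i mod L) = x (Suc i)" if "i < L" for i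
    using that xL x0 by (cases "Suc i = L") auto
  have "lap L x i = y i" if i: "i < L" for i
  proof (cases i)
    case 0
    \<comment> \<open>The left neighbour of site 0 is L - 1; since y sums to zero, the slope there
      has returned to s.\<close>
    have "x L = x (L - 1) + s"
      using step[of "L - 1"] L y by (simp add: lessThan_Suc_atMost[symmetric])
    then have "x (L - 1) = - s" using xL by (simp add: eq_neg_iff_add_eq_0)
    moreover have "x (Suc 0 mod L) = s + y 0"
      using xmod[of 0] step[of 0] i 0 x0 by simp
    ultimately show ?thesis
      using i 0 x0 by (simp add: lap_def)
  next
    case (Suc n)
    have "i + L - 1 = n + L" using Suc by simp
    then have "(i + L - 1) mod L = n" using i Suc by simp
    then show ?thesis
      using i Suc xmod[of i] step[of n] step[of "Suc n"] by (simp add: lap_def algebra_simps)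
  qed
  then show ?thesis by blast
qed

definition lap_lattice :: "nat \<Rightarrow> (nat \<Rightarrow> int) set" where
  "lap_lattice L = {k. (\<Sum>i<L. k i) = 0 \<and> int L dvd (\<Sum>i<L. int i * k i)}"

lemma lap_in_lattice: "L \<ge> 1 \<Longrightarrow> lap L m \<in> lap_lattice L"
  by (simp add: lap_lattice_def sum_lap dvd_sum_index_lap)

text \<open>Divisibility of the weighted sum by L is what makes the initial slope in
  \<open>lap_surj\<close> an integer; over the reals the division is always possible.\<close>

lemma lap_latticeE:
  assumes "L \<ge> 1" "k \<in> lap_lattice L"
  obtains m where "\<And>i. i < L \<Longrightarrow> lap L m i = k i"
proof -
  obtain s where "(\<Sum>i<L. int i * k i) = int L * s"
    using assms by (auto simp: lap_lattice_def)
  then show ?thesis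
    using lap_surj[of L k s] assms that by (auto simp: lap_lattice_def)
qed

lemma lap_surj_real:
  fixes y :: "nat \<Rightarrow> real"
  assumes "L \<ge> 1" "(\<Sum>i<L. y i) = 0"
  obtains x where "\<And>i. i < L \<Longrightarrow> lap L x i = y i"
  using lap_surj[of L y "(\<Sum>i<L. of_nat i * y i) / of_nat L"] assms by auto

lemma lap_add: "lap L (\<lambda>i. x i + y i) i = lap L x i + lap L y i"
  by (simp add: lap_def algebra_simps)

lemma lap_of_int: "lap L (\<lambda>i. of_int (m i)) i = of_int (lap L m i)"
  by (simp add: lap_def)

lemma lap_cong: "(\<And>i. i < L \<Longrightarrow> x i = y i) \<Longrightarrow> L \<ge> 1 \<Longrightarrow> lap L x i = lap L y i"
  by (simp add: lap_def)

subsection \<open>The threshold configuration\<close>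

text \<open>The sum s is a parameter because existence is proved by induction on it; later only s =
  1 matters. Extensionality makes k unique as a function, so that \<open>THE\<close> can select
  it.\<close>

definition balanced :: "nat \<Rightarrow> int \<Rightarrow> (nat \<Rightarrow> real) \<Rightarrow> (nat \<Rightarrow> int) \<Rightarrow> bool" where
  "balanced L s z k \<longleftrightarrow> k \<in> extensional {..<L} \<and> (\<Sum>i<L. k i) = s \<and>
     (\<forall>i<L. \<forall>j<L. z i + of_int (k i) < z j + of_int (k j) + 1)"

text \<open>If k exceeds k' at i, equality of the sums makes it smaller at some j. The gap between
  entries i and j then differs by at least 2 between the two choices, impossible when both spreads
  are below 1.\<close>

lemma balanced_unique:
  assumes k: "balanced L s z k" and k': "balanced L s z k'"
  shows "k = k'"
proof (rule ccontr)
  assume neq: "k \<noteq> k'"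
  have le: "k i \<le> k' i" if i: "i < L"
    and k: "balanced L s z k" and k': "balanced L s z k'" for i and k k' :: "nat \<Rightarrow> int"
  proof (rule ccontr)
    assume gt: "\<not> k i \<le> k' i"
    have "\<exists>j<L. k j < k' j"
    proof (rule ccontr)
      assume "\<not> (\<exists>j<L. k j < k' j)"
      then have "\<forall>j\<in>{..<L}. k' j \<le> k j" by (meson lessThan_iff not_less)
      moreover have "\<exists>j\<in>{..<L}. k' j < k j" using gt i by force
      ultimately have "(\<Sum>j<L. k' j) < (\<Sum>j<L. k j)"
        by (intro sum_strict_mono_ex1) auto
      then show False using k k' by (simp add: balanced_def)
    qed
    then obtain j where j: "j < L" "k j < k' j" by blast
    have "z i + of_int (k i) < z j + of_int (k j) + 1"
      "z j + of_int (k' j) < z i + of_int (k' i) + 1"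
      using k k' i j by (auto simp: balanced_def)
    moreover have "real_of_int (k' i) + 1 \<le> of_int (k i)" "real_of_int (k j) + 1 \<le> of_int (k' j)"
      using gt j by linarith+
    ultimately show False by linarith
  qed
  have "k i = k' i" for i
    using le[of i k k'] le[of i k' k] k k'
    by (cases "i < L") (auto simp: balanced_def extensional_def)
  then show False using neq by blast
qed

text \<open>Raising the smallest entry, or lowering the largest one, keeps the spread below 1
  because no two entries agree modulo 1.\<close>

lemma balanced_ex:
  assumes L: "L \<ge> 1"
    and generic: "\<And>i j. i < L \<Longrightarrow> j < L \<Longrightarrow> i \<noteq> j \<Longrightarrow> z i - z j \<notin> \<int>"
  shows "\<exists>k. balanced L s z k"
proof -
  have ne: "z i + of_int (k i) \<noteq> z j + of_int (k j)"
    if "i < L" "j < L" "i \<noteq> j" for i j and k :: "nat \<Rightarrow> int"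
  proof
    assume "z i + of_int (k i) = z j + of_int (k j)"
    then have "z i - z j = of_int (k j - k i)" by simp
    then show False using generic[OF that] by (metis Ints_of_int)
  qed
  \<comment> \<open>The fractional parts of z are balanced for some sum; the induction climbs and
    descends from there to every integer s.\<close>
  define k0 where "k0 = (\<lambda>i\<in>{..<L}. - \<lfloor>z i\<rfloor>)"
  have k0: "balanced L (\<Sum>i<L. k0 i) z k0"
    unfolding balanced_def k0_def by (auto, linarith)
  show ?thesis
  proof (induction s rule: int_induct[of _ "\<Sum>i<L. k0 i"])
    case base
    show ?case using k0 by blast
  next
    case (step1 s)
    then obtain k where k: "balanced L s z k" by blast
    let ?w = "\<lambda>i. z i + of_int (k i)"
    obtain p where p: "p < L" "\<And>i. i < L \<Longrightarrow> ?w p \<le> ?w i"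
      using ex_min_if_finite[of "?w ` {..<L}"] L
      by (auto simp: image_iff not_less lessThan_empty_iff)
    have less: "?w p < ?w i" if "i < L" "i \<noteq> p" for i
      using p(1) p(2)[of i] ne[of p i k] that by (simp add: order_less_le)
    have "balanced L (s + 1) z (k(p := k p + 1))"
      unfolding balanced_def
    proof (intro conjI allI impI)
      show "k(p := k p + 1) \<in> extensional {..<L}"
        using k p by (auto simp: balanced_def extensional_def)
      show "(\<Sum>i<L. (k(p := k p + 1)) i) = s + 1"
        using k p by (simp add: balanced_def sum.remove[of "{..<L}" p])
      fix i j assume ij: "i < L" "j < L"
      then have "?w i < ?w j + 1" using k by (simp add: balanced_def)
      then show "z i + of_int ((k(p := k p + 1)) i) < z j + of_int ((k(p := k p + 1)) j) + 1"
        using less[of i] less[of j] ij by auto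
    qed
    then show ?case by blast
  next
    case (step2 s)
    then obtain k where k: "balanced L s z k" by blast
    let ?w = "\<lambda>i. z i + of_int (k i)"
    obtain p where p: "p < L" "\<And>i. i < L \<Longrightarrow> ?w i \<le> ?w p"
      using Max_in[of "?w ` {..<L}"] Max_ge[of "?w ` {..<L}"] L
      by (fastforce simp: lessThan_empty_iff)
    have less: "?w i < ?w p" if "i < L" "i \<noteq> p" for i
      using p(1) p(2)[of i] ne[of i p k] that by (simp add: order_less_le)
    have "balanced L (s - 1) z (k(p := k p - 1))"
      unfolding balanced_def
    proof (intro conjI allI impI)
      show "k(p := k p - 1) \<in> extensional {..<L}"
        using k p by (auto simp: balanced_def extensional_def)
      show "(\<Sum>i<L. (k(p := k p - 1)) i) = s - 1"
        using k p by (simp add: balanced_def sum.remove[of "{..<L}" p])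
      fix i j assume ij: "i < L" "j < L"
      then have "?w i < ?w j + 1" using k by (simp add: balanced_def)
      then show "z i + of_int ((k(p := k p - 1)) i) < z j + of_int ((k(p := k p - 1)) j) + 1"
        using less[of i] less[of j] ij by auto
    qed
    then show ?case by blast
  qed
qed

definition balancing :: "nat \<Rightarrow> (nat \<Rightarrow> real) \<Rightarrow> nat \<Rightarrow> int" where
  "balancing L z = (THE k. balanced L 1 z k)"

text \<open>The site j is left free so that one can later sum over all sites. The default vector 0
  does not depend on j, so the translation and permutation rules hold in the degenerate case as
  well.\<close>

definition lowered :: "nat \<Rightarrow> (nat \<Rightarrow> real) \<Rightarrow> nat \<Rightarrow> nat \<Rightarrow> real" where
  "lowered L z j = (if \<exists>k. balanced L 1 z k
     then (\<lambda>i\<in>{..<L}. z i + of_int (balancing L z i) - (if i = j then 1 else 0))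
     else (\<lambda>i\<in>{..<L}. 0))"

text \<open>The only site j < L for which the balancing vector minus the unit vector at j has
  weighted sum divisible by L, hence is the Laplacian of an integer configuration.\<close>

definition lowered_site :: "nat \<Rightarrow> (nat \<Rightarrow> real) \<Rightarrow> nat" where
  "lowered_site L z = nat ((\<Sum>i<L. int i * balancing L z i) mod int L)"

text \<open>An explicit, measurable substitute for the \<open>SOME\<close> in
  \<open>threshold_z\<close>.\<close>

definition reduced_z :: "nat \<Rightarrow> (nat \<Rightarrow> real) \<Rightarrow> nat \<Rightarrow> real" where
  "reduced_z L z = lowered L z (lowered_site L z)"

lemma balancing_eq: "balanced L 1 z k \<Longrightarrow> balancing L z = k"
  unfolding balancing_def by (rule the_equality) (auto intro: balanced_unique)

lemma balanced_balancing: "\<exists>k. balanced L 1 z k \<Longrightarrow> balanced L 1 z (balancing L z)"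
  using balancing_eq by auto

section \<open>Behaviour under sum-zero translations\<close>

definition shifted :: "nat \<Rightarrow> (nat \<Rightarrow> real) \<Rightarrow> (nat \<Rightarrow> real) \<Rightarrow> nat \<Rightarrow> real" where
  "shifted L z y = (\<lambda>i\<in>{..<L}. z i + y i)"

lemma balanced_shifted:
  fixes y :: "nat \<Rightarrow> int"
  assumes "balanced L s z k" "(\<Sum>i<L. y i) = 0"
  shows "balanced L s (shifted L z (\<lambda>i. of_int (y i))) (\<lambda>i\<in>{..<L}. k i - y i)"
  using assms by (auto simp: balanced_def shifted_def sum_subtractf)

lemma balanced_ex_shifted:
  fixes y :: "nat \<Rightarrow> int"
  assumes "(\<Sum>i<L. y i) = 0"
  shows "(\<exists>k. balanced L s (shifted L z (\<lambda>i. of_int (y i))) k) \<longleftrightarrow> (\<exists>k. balanced L s z k)"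
proof
  assume "\<exists>k. balanced L s (shifted L z (\<lambda>i. of_int (y i))) k"
  then obtain k where "balanced L s (shifted L z (\<lambda>i. of_int (y i))) k" by blast
  then have "balanced L s z (\<lambda>i\<in>{..<L}. k i + y i)"
    using assms by (auto simp: balanced_def shifted_def sum.distrib algebra_simps)
  then show "\<exists>k. balanced L s z k" by blast
qed (use assms balanced_shifted in blast)

lemma balancing_shifted:
  fixes y :: "nat \<Rightarrow> int"
  assumes "\<exists>k. balanced L 1 z k" "(\<Sum>i<L. y i) = 0"
  shows "balancing L (shifted L z (\<lambda>i. of_int (y i))) = (\<lambda>i\<in>{..<L}. balancing L z i - y i)"
  using assms by (intro balancing_eq balanced_shifted balanced_balancing)

text \<open>By uniqueness the balancing vector absorbs the integer translation, so the balanced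
  entries do not move.\<close>

lemma lowered_shifted:
  fixes y :: "nat \<Rightarrow> int"
  assumes "(\<Sum>i<L. y i) = 0"
  shows "lowered L (shifted L z (\<lambda>i. of_int (y i))) j = lowered L z j"
proof (cases "\<exists>k. balanced L 1 z k")
  case True
  then show ?thesis
    unfolding lowered_def balanced_ex_shifted[OF assms] balancing_shifted[OF True assms]
    by (auto simp: shifted_def)
next
  case False
  then show ?thesis
    unfolding lowered_def balanced_ex_shifted[OF assms] by (simp only: if_False)
qed

lemma lowered_site_shifted:
  fixes y :: "nat \<Rightarrow> int"
  assumes "\<exists>k. balanced L 1 z k" "(\<Sum>i<L. y i) = 0"
  shows "lowered_site L (shifted L z (\<lambda>i. of_int (y i))) =
    nat (((\<Sum>i<L. int i * balancing L z i) - (\<Sum>i<L. int i * y i)) mod int L)"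
  unfolding lowered_site_def balancing_shifted[OF assms]
  by (simp add: algebra_simps sum_subtractf)

lemma lowered_degenerate:
  "\<not> (\<exists>k. balanced L 1 z k) \<Longrightarrow> lowered L z i = lowered L z j"
  by (simp add: lowered_def)

text \<open>A sum-zero integer translation affects only the lowered site, by the weighted sum of y
  modulo L, and this vanishes on the lattice.\<close>

lemma reduced_z_shifted:
  assumes "y \<in> lap_lattice L"
  shows "reduced_z L (shifted L z (\<lambda>i. of_int (y i))) = reduced_z L z"
proof -
  have y: "(\<Sum>i<L. y i) = 0" "(\<Sum>i<L. int i * y i) mod int L = 0"
    using assms by (auto simp: lap_lattice_def)
  show ?thesis
  proof (cases "\<exists>k. balanced L 1 z k")
    case True
    have "lowered_site L (shifted L z (\<lambda>i. of_int (y i))) = lowered_site L z"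
      unfolding lowered_site_shifted[OF True y(1)] unfolding lowered_site_def
      by (subst mod_diff_right_eq[symmetric]) (simp add: y(2))
    then show ?thesis
      by (simp add: reduced_z_def lowered_shifted[OF y(1)])
  next
    case False
    then show ?thesis
      unfolding reduced_z_def lowered_shifted[OF y(1)] by (rule lowered_degenerate)
  qed
qed

text \<open>For s < L these vectors represent the cosets of the image lattice in the sum-zero
  integer vectors, told apart by their weighted sum s.\<close>

definition transfer :: "nat \<Rightarrow> nat \<Rightarrow> int" where
  "transfer s i = (if i = s then 1 else 0) - (if i = 0 then 1 else 0)"

lemma sum_transfer: "s < L \<Longrightarrow> (\<Sum>i<L. transfer s i) = 0"
  by (simp add: transfer_def sum_subtractf)

lemma sum_index_transfer: "s < L \<Longrightarrow> (\<Sum>i<L. int i * transfer s i) = int s"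
  by (simp add: transfer_def right_diff_distrib sum_subtractf if_distrib[of "\<lambda>x. _ * x"] cong: if_cong)

text \<open>Translating by the coset representatives moves the lowered site through every site
  exactly once.\<close>

lemma sum_reduced_z_transfer:
  fixes h :: "(nat \<Rightarrow> real) \<Rightarrow> 'a::comm_monoid_add"
  assumes L: "L \<ge> 1"
  shows "(\<Sum>s<L. h (reduced_z L (shifted L z (\<lambda>i. of_int (transfer s i))))) =
    (\<Sum>j<L. h (lowered L z j))"
proof (cases "\<exists>k. balanced L 1 z k")
  case True
  define c where "c = (\<Sum>i<L. int i * balancing L z i)"
  have "(\<Sum>s<L. h (reduced_z L (shifted L z (\<lambda>i. of_int (transfer s i))))) =
      (\<Sum>s<L. h (lowered L z (nat ((c - int s) mod int L))))"
    by (rule sum.cong) (simp_all add: reduced_z_def lowered_shifted lowered_site_shifted[OF True]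
          sum_transfer sum_index_transfer c_def)
  also have "\<dots> = (\<Sum>j<L. h (lowered L z j))"
  proof -
    \<comment> \<open>Reflection j to c - j modulo L is an involution, so it serves as its own
      inverse in the reindexing.\<close>
    have inv: "nat ((c - int (nat ((c - int j) mod int L))) mod int L) = j" if "j < L" for j
      using that L by (simp add: mod_diff_right_eq)
    have range: "nat ((c - int j) mod int L) < L" for j
      using L by (simp add: nat_less_iff)
    show ?thesis
      by (rule sum.reindex_bij_witness[where i="\<lambda>j. nat ((c - int j) mod int L)"
            and j="\<lambda>j. nat ((c - int j) mod int L)"]) (use inv range in auto)
  qed
  finally show ?thesis .
next
  case False
  show ?thesis
    by (rule sum.cong)
      (auto simp: reduced_z_def lowered_shifted sum_transfer intro!: arg_cong[of _ _ h] lowered_degenerate[OF False])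
qed

section \<open>Equivariance under permutations\<close>

definition permuted :: "nat \<Rightarrow> (nat \<Rightarrow> nat) \<Rightarrow> (nat \<Rightarrow> 'a) \<Rightarrow> nat \<Rightarrow> 'a" where
  "permuted L \<sigma> z = (\<lambda>i\<in>{..<L}. z (\<sigma> i))"

lemma permutes_less: "\<sigma> permutes {..<L} \<Longrightarrow> i < L \<Longrightarrow> \<sigma> i < L"
  using permutes_in_image[of \<sigma> "{..<L}" i] by simp

lemma sum_permuted:
  "\<sigma> permutes {..<L} \<Longrightarrow> (\<Sum>i<L. permuted L \<sigma> z i) = (\<Sum>i<L. z i)"
  using sum.permute[of \<sigma> "{..<L}" z] by (simp add: permuted_def comp_def)

lemma balanced_permuted:
  assumes "\<sigma> permutes {..<L}" "balanced L s z k"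
  shows "balanced L s (permuted L \<sigma> z) (permuted L \<sigma> k)"
  using assms(2) unfolding balanced_def sum_permuted[OF assms(1)]
  by (auto simp: permuted_def permutes_less[OF assms(1)])

lemma balanced_cong: "(\<And>i. i < L \<Longrightarrow> z i = z' i) \<Longrightarrow> balanced L s z k \<longleftrightarrow> balanced L s z' k"
  by (simp add: balanced_def)

lemma balanced_ex_permuted:
  assumes "\<sigma> permutes {..<L}"
  shows "(\<exists>k. balanced L s (permuted L \<sigma> z) k) \<longleftrightarrow> (\<exists>k. balanced L s z k)"
proof
  assume "\<exists>k. balanced L s (permuted L \<sigma> z) k"
  then obtain k where "balanced L s (permuted L \<sigma> z) k" by blast
  from balanced_permuted[OF permutes_inv[OF assms] this]
  have "balanced L s z (permuted L (inv \<sigma>) k)"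
    by (rule balanced_cong[THEN iffD1, rotated])
      (simp add: permuted_def permutes_inverses[OF assms] permutes_less[OF permutes_inv[OF assms]])
  then show "\<exists>k. balanced L s z k" by blast
qed (use assms balanced_permuted in blast)

text \<open>Permuting a balancing vector balances the permuted entries, so uniqueness gives
  equivariance; site j after permuting is site \<open>\<sigma> j\<close> before.\<close>

lemma lowered_permuted:
  assumes \<sigma>: "\<sigma> permutes {..<L}"
  shows "lowered L (permuted L \<sigma> z) j = permuted L \<sigma> (lowered L z (\<sigma> j))"
proof (cases "\<exists>k. balanced L 1 z k")
  case True
  have "balancing L (permuted L \<sigma> z) = permuted L \<sigma> (balancing L z)"
    using True by (intro balancing_eq balanced_permuted[OF \<sigma>] balanced_balancing)
  moreover have "\<sigma> i = \<sigma> j \<longleftrightarrow> i = j" for i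
    using permutes_inj[OF \<sigma>] by (simp add: inj_eq)
  ultimately show ?thesis
    using True permutes_less[OF \<sigma>]
    unfolding lowered_def balanced_ex_permuted[OF \<sigma>]
    by (auto simp: permuted_def fun_eq_iff)
next
  case False
  then show ?thesis
    using permutes_less[OF \<sigma>]
    unfolding lowered_def balanced_ex_permuted[OF \<sigma>]
    by (auto simp: permuted_def fun_eq_iff)
qed

text \<open>The weights in \<open>lowered_site\<close> depend on the order of the sites, so
  equivariance is available only after summing over the lowered site.\<close>

lemma sum_lowered_permuted:
  fixes h :: "(nat \<Rightarrow> real) \<Rightarrow> 'a::comm_monoid_add"
  assumes "\<sigma> permutes {..<L}"
  shows "(\<Sum>j<L. h (lowered L (permuted L \<sigma> z) j)) = (\<Sum>j<L. h (permuted L \<sigma> (lowered L z j)))"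
  unfolding lowered_permuted[OF assms]
  using sum.permute[OF assms, of "\<lambda>j. h (permuted L \<sigma> (lowered L z j))"] by (simp add: comp_def)

section \<open>Identification of the threshold configuration\<close>

definition lap_vec :: "nat \<Rightarrow> (nat \<Rightarrow> real) \<Rightarrow> nat \<Rightarrow> real" where
  "lap_vec L \<alpha> = (\<lambda>i\<in>{..<L}. lap L \<alpha> i)"

text \<open>A competitor with no larger maximum lies below \<open>z + balancing L z\<close>, whose entries have
  spread less than 1; comparing sums, it arises by lowering a single entry, and the weighted
  sum modulo \<open>L\<close> determines which one.\<close>

lemma maxz_le_imp_eq:
  assumes L: "L \<ge> 1" and k: "balanced L 1 (lap L \<alpha>) k"
    and m: "\<And>i. i < L \<Longrightarrow> lap L m i = k i - (if i = j then 1 else 0)" and j: "j < L"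
    and le: "maxz L \<alpha> m' \<le> maxz L \<alpha> m" and i: "i < L"
  shows "lap L m' i = lap L m i"
proof -
  have fin: "finite (zcoord L \<alpha> n ` {..<L})" "zcoord L \<alpha> n ` {..<L} \<noteq> {}" for n
    using L by (auto simp: lessThan_empty_iff)
  obtain p where p: "p < L" "maxz L \<alpha> m = zcoord L \<alpha> m p"
    using Max_in[OF fin[of m]] by (auto simp: maxz_def)
  \<comment> \<open>Exceeding k at i would put the entry of m' at least 1 above the balanced one,
    hence above every balanced entry and above the maximum for m.\<close>
  have below: "lap L m' i \<le> k i" if i: "i < L" for i
  proof (rule ccontr)
    assume "\<not> lap L m' i \<le> k i"
    then have "real_of_int (k i) + 1 \<le> of_int (lap L m' i)" by linarith
    moreover have "zcoord L \<alpha> m' i \<le> maxz L \<alpha> m'"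
      unfolding maxz_def using i fin by (intro Max_ge) auto
    moreover have "zcoord L \<alpha> m p \<le> lap L \<alpha> p + of_int (k p)"
      using m[OF p(1)] by (simp add: zcoord_def)
    moreover have "lap L \<alpha> p + of_int (k p) < lap L \<alpha> i + of_int (k i) + 1"
      using k p i by (simp add: balanced_def)
    ultimately show False using le p by (simp add: zcoord_def)
  qed
  \<comment> \<open>The deficits are nonnegative integers with sum 1, so exactly one of them is 1,
    at a site q.\<close>
  define d where "d i = k i - lap L m' i" for i
  have d0: "d i \<ge> 0" if "i < L" for i using below[OF that] by (simp add: d_def)
  have dsum: "(\<Sum>i<L. d i) = 1"
    using k sum_lap[OF L, of m'] by (simp add: d_def sum_subtractf balanced_def)
  have "\<exists>q<L. d q \<ge> 1"
  proof (rule ccontr)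
    assume "\<not> ?thesis"
    then have "(\<Sum>i<L. d i) \<le> 0" by (intro sum_nonpos) force
    then show False using dsum by simp
  qed
  then obtain q where q: "q < L" "d q \<ge> 1" by blast
  have "(\<Sum>i<L. d i) = d q + (\<Sum>i\<in>{..<L} - {q}. d i)"
    using q by (simp add: sum.remove)
  moreover have "(\<Sum>i\<in>{..<L} - {q}. d i) \<ge> 0"
    using d0 by (intro sum_nonneg) auto
  ultimately have dq: "d q = 1" and rest: "(\<Sum>i\<in>{..<L} - {q}. d i) = 0"
    using dsum q by linarith+
  have dz: "d i = 0" if "i < L" "i \<noteq> q" for i
    using rest that d0 by (subst (asm) sum_nonneg_eq_0_iff) auto
  have d: "d i = (if i = q then 1 else 0)" if "i < L" for i
    using dq dz that by auto
  have diff: "lap L m i - lap L m' i = (if i = q then 1 else 0) - (if i = j then 1 else 0)"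
    if "i < L" for i
    using m[OF that] d[OF that] by (simp add: d_def)
  \<comment> \<open>Both Laplacians have weighted sum divisible by L, and their difference is the
    unit vector at q minus the one at j, so q and j agree modulo L.\<close>
  have "int L dvd (\<Sum>i<L. int i * lap L m i) - (\<Sum>i<L. int i * lap L m' i)"
    by (intro dvd_diff dvd_sum_index_lap L)
  also have "\<dots> = (\<Sum>i<L. int i * (if i = q then 1 else 0) - int i * (if i = j then 1 else 0))"
    unfolding sum_subtractf[symmetric] right_diff_distrib[symmetric]
    by (rule sum.cong) (simp_all only: diff lessThan_iff)
  also have "\<dots> = int q - int j"
    using q j by (simp add: sum_subtractf if_distrib[of "\<lambda>x. _ * x"] cong: if_cong)
  finally have "int q mod int L = int j mod int L" by (simp add: mod_eq_dvd_iff)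
  then have "q = j" using q j by simp
  then show ?thesis using d[OF i] m[OF i] by (simp add: d_def)
qed

text \<open>The choice of the lowered site puts the lowered vector into the image lattice, giving a
  configuration m. Any m' with no larger maximum has the same Laplacian, so m is a minimizer and the
  choice made by \<open>SOME\<close> is immaterial.\<close>

lemma threshold_z_eq_reduced_z:
  assumes L: "L \<ge> 1" and ex: "\<exists>k. balanced L 1 (lap_vec L \<alpha>) k"
  shows "threshold_z L \<alpha> = reduced_z L (lap_vec L \<alpha>)"
proof -
  define k where "k = balancing L (lap_vec L \<alpha>)"
  define j where "j = lowered_site L (lap_vec L \<alpha>)"
  have "balanced L 1 (lap_vec L \<alpha>) k"
    unfolding k_def using ex by (rule balanced_balancing)
  then have k: "balanced L 1 (lap L \<alpha>) k"
    by (rule balanced_cong[THEN iffD1, rotated]) (simp add: lap_vec_def)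
  have j: "j < L" using L by (simp add: j_def lowered_site_def nat_less_iff)
  define y where "y i = k i - (if i = j then 1 else 0)" for i
  have "(\<Sum>i<L. y i) = 0"
    using k j by (simp add: y_def sum_subtractf balanced_def)
  moreover have "(\<Sum>i<L. int i * y i) = (\<Sum>i<L. int i * k i) - int j"
    using j by (simp add: y_def right_diff_distrib sum_subtractf if_distrib[of "\<lambda>x. _ * x"] cong: if_cong)
  moreover have "int j = (\<Sum>i<L. int i * k i) mod int L"
    using L by (simp add: j_def lowered_site_def k_def)
  ultimately have "y \<in> lap_lattice L"
    by (simp add: lap_lattice_def)
  then obtain m where m: "\<And>i. i < L \<Longrightarrow> lap L m i = y i"
    using lap_latticeE[OF L] by metis
  have eq: "lap L m' i = lap L m i" if "maxz L \<alpha> m' \<le> maxz L \<alpha> m" "i < L" for m' i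
    using maxz_le_imp_eq[OF L k _ j that] m by (simp add: y_def)
  have "is_threshold L \<alpha> m"
    unfolding is_threshold_def
  proof
    fix m'
    show "maxz L \<alpha> m \<le> maxz L \<alpha> m'"
    proof (cases "maxz L \<alpha> m' \<le> maxz L \<alpha> m")
      case True
      have "zcoord L \<alpha> m' ` {..<L} = zcoord L \<alpha> m ` {..<L}"
        using eq[OF True] by (intro image_cong) (auto simp: zcoord_def)
      then show ?thesis by (simp add: maxz_def)
    qed simp
  qed
  then have "is_threshold L \<alpha> (SOME m. is_threshold L \<alpha> m)"
    by (rule someI[of "is_threshold L \<alpha>"])
  then have "lap L (SOME m. is_threshold L \<alpha> m) i = y i" if "i < L" for i
    using eq m that by (simp add: is_threshold_def)
  moreover have "lap_vec L \<alpha> i = lap L \<alpha> i" if "i < L" for i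
    using that by (simp add: lap_vec_def)
  ultimately show ?thesis
    using ex by (auto simp: threshold_z_def reduced_z_def lowered_def zcoord_def y_def
        k_def[symmetric] j_def[symmetric] fun_eq_iff)
qed

subsection \<open>Rotation invariance of the disorder\<close>

definition unif :: "real measure" where
  "unif = uniform_measure lborel {-1/2<..<1/2}"

abbreviation unif_vec :: "nat \<Rightarrow> (nat \<Rightarrow> real) measure" where
  "unif_vec L \<equiv> PiM {..<L} (\<lambda>_. unif)"

lemma prob_space_unif: "prob_space unif"
  unfolding unif_def by (rule prob_space_uniform_measure) auto

lemma sets_unif [simp, measurable_cong]: "sets unif = sets borel"
  by (simp add: unif_def)

lemma space_unif [simp]: "space unif = UNIV"
  by (simp add: unif_def)

lemma prob_space_unif_vec: "prob_space (unif_vec L)"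
  by (intro prob_space_PiM prob_space_unif)

lemma sets_unif_vec [measurable_cong]: "sets (unif_vec L) = sets (vec_space L)"
  unfolding vec_space_def by (intro sets_PiM_cong) auto

text \<open>Adding an endpoint costs a null set and yields a fundamental domain for translation by
  1, whose translates can be cut and glued without overlap.\<close>

lemma nn_integral_unif:
  assumes [measurable]: "f \<in> borel_measurable borel"
  shows "(\<integral>\<^sup>+x. f x \<partial>unif) = (\<integral>\<^sup>+x. f x * indicator {-1/2..<1/2} x \<partial>lborel)"
proof -
  have "(\<integral>\<^sup>+x. f x \<partial>unif) = (\<integral>\<^sup>+x. f x * indicator {-1/2<..<1/2} x \<partial>lborel)"
    unfolding unif_def by (subst nn_integral_uniform_measure) (auto simp: divide_ennreal_def)
  also have "\<dots> = (\<integral>\<^sup>+x. f x * indicator {-1/2..<1/2} x \<partial>lborel)"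
    by (rule nn_integral_cong_AE, rule AE_mp[OF AE_lborel_singleton[of "-1/2"]])
       (auto simp: indicator_def)
  finally show ?thesis .
qed

lemma nn_integral_unif_rotate:
  fixes f :: "real \<Rightarrow> ennreal"
  assumes [measurable]: "f \<in> borel_measurable borel" and per: "\<And>x. f (x + 1) = f x"
  shows "(\<integral>\<^sup>+x. f (x + b) \<partial>unif) = (\<integral>\<^sup>+x. f x \<partial>unif)"
proof -
  have nat: "f (x + of_nat n) = f x" for x n
    by (induction n) (simp_all add: per add.assoc[symmetric] add.commute[of 1])
  have int: "f (x + of_int n) = f x" for x n
    using nat[of x "nat n"] nat[of "x + of_int n" "nat (- n)"] by (cases "n \<ge> 0") simp_all
  \<comment> \<open>Periodicity reduces the shift to its fractional part; after translating, the
    piece of the interval beyond 1/2 is moved back by one period.\<close>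
  define c where "c = frac b"
  have c: "0 \<le> c" "c < 1" by (auto simp: c_def frac_lt_1)
  have "f (x + b) = f (x + c)" for x
    using int[of "x + c" "\<lfloor>b\<rfloor>"] by (simp add: c_def frac_def)
  then have "(\<integral>\<^sup>+x. f (x + b) \<partial>unif) = (\<integral>\<^sup>+x. f (x + c) * indicator {-1/2..<1/2} x \<partial>lborel)"
    using nn_integral_unif[of "\<lambda>x. f (x + c)"] by simp
  also have "\<dots> = (\<integral>\<^sup>+x. f x * indicator {-1/2+c..<1/2+c} x \<partial>lborel)"
    by (subst nn_integral_real_affine[where c=1 and t="c", of "\<lambda>x. f x * indicator {-1/2+c..<1/2+c} x"])
      (auto intro!: nn_integral_cong simp: indicator_def add.commute)
  also have "\<dots> = (\<integral>\<^sup>+x. f x * indicator {-1/2+c..<1/2} x + f x * indicator {1/2..<1/2+c} x \<partial>lborel)"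
    using c by (intro nn_integral_cong) (auto simp: indicator_def)
  also have "\<dots> = (\<integral>\<^sup>+x. f x * indicator {-1/2+c..<1/2} x \<partial>lborel)
      + (\<integral>\<^sup>+x. f x * indicator {1/2..<1/2+c} x \<partial>lborel)"
    by (rule nn_integral_add) auto
  also have "(\<integral>\<^sup>+x. f x * indicator {1/2..<1/2+c} x \<partial>lborel) =
      (\<integral>\<^sup>+x. f x * indicator {-1/2..<-1/2+c} x \<partial>lborel)"
    by (subst nn_integral_real_affine[where c=1 and t="1"])
      (auto intro!: nn_integral_cong simp: indicator_def per add.commute)
  also have "(\<integral>\<^sup>+x. f x * indicator {-1/2+c..<1/2} x \<partial>lborel) + \<dots> =
      (\<integral>\<^sup>+x. f x * indicator {-1/2+c..<1/2} x + f x * indicator {-1/2..<-1/2+c} x \<partial>lborel)"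
    by (rule nn_integral_add[symmetric]) auto
  also have "\<dots> = (\<integral>\<^sup>+x. f x * indicator {-1/2..<1/2} x \<partial>lborel)"
    using c by (intro nn_integral_cong) (auto simp: indicator_def)
  also have "\<dots> = (\<integral>\<^sup>+x. f x \<partial>unif)"
    by (rule nn_integral_unif[symmetric]) measurable
  finally show ?thesis .
qed

text \<open>The representative modulo 1 in the half-open interval from -1/2 to 1/2.\<close>

definition wrap :: "real \<Rightarrow> real" where
  "wrap x = x - of_int \<lfloor>x + 1/2\<rfloor>"

lemma wrap_measurable [measurable]: "wrap \<in> borel_measurable borel"
  unfolding wrap_def by measurable

lemma wrap_add_1: "wrap (x + 1) = wrap x"
proof -
  have "x + 1 + 1/2 = (x + 1/2) + 1" by simp
  then show ?thesis unfolding wrap_def by (simp only: one_add_floor[symmetric] of_int_add of_int_1 add_diff_add diff_self add_0_right)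
qed

lemma emeasure_unif_wrap:
  assumes [measurable]: "A \<in> sets borel"
  shows "emeasure unif {x. wrap (x + b) \<in> A} = emeasure unif A"
proof -
  have "emeasure unif {x. wrap (x + b) \<in> A} = (\<integral>\<^sup>+x. indicator A (wrap (x + b)) \<partial>unif)"
    by (subst nn_integral_indicator[symmetric])
      (auto intro!: nn_integral_cong simp del: nn_integral_indicator split: split_indicator)
  also have "\<dots> = (\<integral>\<^sup>+x. indicator A (wrap x) \<partial>unif)"
    by (rule nn_integral_unif_rotate) (auto simp: wrap_add_1)
  also have "\<dots> = (\<integral>\<^sup>+x. indicator A (wrap x) * indicator {-1/2..<1/2} x \<partial>lborel)"
    by (rule nn_integral_unif) measurable
  also have "\<dots> = (\<integral>\<^sup>+x. indicator A x * indicator {-1/2..<1/2} x \<partial>lborel)"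
  proof (rule nn_integral_cong)
    fix x :: real
    have "wrap x = x" if "-1/2 \<le> x" "x < 1/2"
    proof -
      have "\<lfloor>x + 1/2\<rfloor> = 0" using that by (intro floor_unique) auto
      then show ?thesis by (simp add: wrap_def)
    qed
    then show "indicator A (wrap x) * indicator {-1/2..<1/2} x =
        (indicator A x * indicator {-1/2..<1/2} x :: ennreal)"
      by (auto simp: indicator_def)
  qed
  also have "\<dots> = (\<integral>\<^sup>+x. indicator A x \<partial>unif)"
    by (rule nn_integral_unif[symmetric]) measurable
  also have "\<dots> = emeasure unif A" by simp
  finally show ?thesis .
qed

lemma component_measurable:
  "i < L \<Longrightarrow> (\<lambda>x. x i) \<in> borel_measurable (vec_space L)"
  unfolding vec_space_def by (intro measurable_component_singleton) auto

lemma rotate_measurable: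
  "(\<lambda>\<alpha>. \<lambda>i\<in>{..<L}. wrap (\<alpha> i + b i)) \<in> measurable (unif_vec L) (unif_vec L)"
proof (rule measurable_restrict)
  fix i assume "i \<in> {..<L}"
  then have "(\<lambda>\<alpha>. \<alpha> i) \<in> borel_measurable (unif_vec L)"
    unfolding measurable_cong_sets[OF sets_unif_vec refl] by (simp add: component_measurable)
  then show "(\<lambda>\<alpha>. wrap (\<alpha> i + b i)) \<in> measurable (unif_vec L) unif"
    by simp
qed

text \<open>Rotation acts coordinatewise, so preimages of boxes are boxes, and boxes determine a
  product measure.\<close>

lemma distr_unif_vec_wrap:
  "distr (unif_vec L) (unif_vec L) (\<lambda>\<alpha>. \<lambda>i\<in>{..<L}. wrap (\<alpha> i + b i)) = unif_vec L"
proof -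
  interpret prob_space unif by (rule prob_space_unif)
  interpret product_sigma_finite "\<lambda>_::nat. unif" ..
  let ?R = "\<lambda>\<alpha>. \<lambda>i\<in>{..<L}. wrap (\<alpha> i + b i)"
  note R = rotate_measurable[of b L]
  show ?thesis
  proof (rule PiM_eqI)
    fix A :: "nat \<Rightarrow> real set" assume A: "\<And>i. i \<in> {..<L} \<Longrightarrow> A i \<in> sets unif"
    have "emeasure (distr (unif_vec L) (unif_vec L) ?R) (Pi\<^sub>E {..<L} A) =
        emeasure (unif_vec L) (?R -` Pi\<^sub>E {..<L} A \<inter> space (unif_vec L))"
      using R A by (intro emeasure_distr sets_PiM_I_finite) auto
    also have "?R -` Pi\<^sub>E {..<L} A \<inter> space (unif_vec L) = Pi\<^sub>E {..<L} (\<lambda>i. {x. wrap (x + b i) \<in> A i})"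
      by (rule set_eqI) (simp add: space_PiM PiE_iff)
    also have "emeasure (unif_vec L) \<dots> = (\<Prod>i<L. emeasure unif {x. wrap (x + b i) \<in> A i})"
    proof (rule emeasure_PiM)
      fix i assume "i \<in> {..<L}"
      then have [measurable]: "A i \<in> sets borel" using A by simp
      show "{x. wrap (x + b i) \<in> A i} \<in> sets unif" by simp
    qed simp
    also have "\<dots> = (\<Prod>i<L. emeasure unif (A i))"
      using A by (intro prod.cong emeasure_unif_wrap) auto
    finally show "emeasure (distr (unif_vec L) (unif_vec L) ?R) (Pi\<^sub>E {..<L} A) =
        (\<Prod>i<L. emeasure unif (A i))" .
  qed simp_all
qed

lemma lap_vec_measurable [measurable]:
  assumes "L \<ge> 1"
  shows "lap_vec L \<in> measurable (vec_space L) (vec_space L)"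
proof -
  have [measurable]: "(\<lambda>x. x (n mod L)) \<in> borel_measurable (vec_space L)" for n
    unfolding vec_space_def using assms by (intro measurable_component_singleton) auto
  show ?thesis
    unfolding lap_vec_def lap_def
    by (subst (2) vec_space_def, rule measurable_restrict) measurable
qed

lemma shifted_measurable [measurable]:
  assumes "f \<in> measurable M (vec_space L)" "g \<in> measurable M (vec_space L)"
  shows "(\<lambda>x. shifted L (f x) (g x)) \<in> measurable M (vec_space L)"
proof -
  have [measurable]: "(\<lambda>x. f x i) \<in> borel_measurable M" "(\<lambda>x. g x i) \<in> borel_measurable M" if "i < L" for i
    using measurable_compose[OF assms(1) component_measurable[OF that]]
      measurable_compose[OF assms(2) component_measurable[OF that]] by auto
  show ?thesis
    unfolding shifted_def by (subst vec_space_def, rule measurable_restrict) (simp add: component_measurable)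
qed

lemma shifted_measurable_const:
  "(\<lambda>z. shifted L z y) \<in> measurable (vec_space L) (vec_space L)"
  unfolding shifted_def
  by (subst (2) vec_space_def, rule measurable_restrict)
    (auto intro!: borel_measurable_add component_measurable)

lemma permuted_measurable:
  "\<sigma> permutes {..<L} \<Longrightarrow> permuted L \<sigma> \<in> measurable (vec_space L) (vec_space L)"
  unfolding permuted_def by (subst (2) vec_space_def, rule measurable_restrict) (simp add: permutes_less component_measurable)

text \<open>The law of \<open>\<Delta>\<alpha>\<close> modulo the lattice is Haar measure on the torus of sum-zero vectors.\<close>

lemma nn_integral_lap_vec_shifted:
  assumes L: "L \<ge> 1" and F[measurable]: "F \<in> borel_measurable (vec_space L)"
    and per: "\<And>z k. z \<in> space (vec_space L) \<Longrightarrow> k \<in> lap_lattice L \<Longrightarrow>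
      F (shifted L z (\<lambda>i. of_int (k i))) = F z"
    and y: "(\<Sum>i<L. y i) = 0"
  shows "(\<integral>\<^sup>+\<alpha>. F (shifted L (lap_vec L \<alpha>) y) \<partial>unif_vec L) = (\<integral>\<^sup>+\<alpha>. F (lap_vec L \<alpha>) \<partial>unif_vec L)"
proof -
  note lap_vec_measurable[OF L, measurable]
  \<comment> \<open>As y is the Laplacian of a real vector b, translating by y amounts to rotating
    the disorder by b.\<close>
  obtain b where b: "\<And>i. i < L \<Longrightarrow> lap L b i = y i"
    using lap_surj_real[OF L y] by blast
  let ?R = "\<lambda>\<alpha>. \<lambda>i\<in>{..<L}. wrap (\<alpha> i + b i)"
  note R = rotate_measurable[of b L]
  have "(\<integral>\<^sup>+\<alpha>. F (lap_vec L \<alpha>) \<partial>unif_vec L) =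
      (\<integral>\<^sup>+\<alpha>. F (lap_vec L \<alpha>) \<partial>distr (unif_vec L) (unif_vec L) ?R)"
    by (simp only: distr_unif_vec_wrap)
  also have "\<dots> = (\<integral>\<^sup>+\<alpha>. F (lap_vec L (?R \<alpha>)) \<partial>unif_vec L)"
    by (rule nn_integral_distr[OF R]) measurable
  also have "\<dots> = (\<integral>\<^sup>+\<alpha>. F (shifted L (lap_vec L \<alpha>) y) \<partial>unif_vec L)"
  proof (rule nn_integral_cong)
    fix \<alpha> :: "nat \<Rightarrow> real"
    \<comment> \<open>Wrapping changes the rotated disorder by the integers n, whose Laplacian lies
      in the lattice of periods of F.\<close>
    define n where "n i = - \<lfloor>\<alpha> i + b i + 1/2\<rfloor>" for i
    have "lap L (?R \<alpha>) i = lap L (\<lambda>i. (\<alpha> i + b i) + of_int (n i)) i" for i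
      using L by (intro lap_cong) (auto simp: wrap_def n_def)
    then have "lap L (?R \<alpha>) i = lap L \<alpha> i + y i + of_int (lap L n i)" if "i < L" for i
      using b[OF that] by (simp only: lap_add lap_of_int)
    then have "lap_vec L (?R \<alpha>) = shifted L (shifted L (lap_vec L \<alpha>) y) (\<lambda>i. of_int (lap L n i))"
      by (auto simp: lap_vec_def shifted_def)
    moreover have "shifted L (lap_vec L \<alpha>) y \<in> space (vec_space L)"
      by (simp add: vec_space_def space_PiM shifted_def)
    ultimately show "F (lap_vec L (?R \<alpha>)) = F (shifted L (lap_vec L \<alpha>) y)"
      using per lap_in_lattice[OF L] by metis
  qed
  finally show ?thesis by simp
qed

subsection \<open>Exchangeability\<close>

lemma balanced_sets: "{z \<in> space (vec_space L). balanced L s z k} \<in> sets (vec_space L)"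
proof (cases "k \<in> extensional {..<L} \<and> (\<Sum>i<L. k i) = s")
  case True
  have "{z \<in> space (vec_space L). \<forall>i\<in>{..<L}. \<forall>j\<in>{..<L}. z i + of_int (k i) < z j + of_int (k j) + 1}
      \<in> sets (vec_space L)"
    by (intro sets.sets_Collect_finite_All borel_measurable_less borel_measurable_add
        component_measurable borel_measurable_const) auto
  also have "{z \<in> space (vec_space L). \<forall>i\<in>{..<L}. \<forall>j\<in>{..<L}. z i + of_int (k i) < z j + of_int (k j) + 1}
      = {z \<in> space (vec_space L). balanced L s z k}"
    using True unfolding balanced_def by blast
  finally show ?thesis .
next
  case False
  then have "{z \<in> space (vec_space L). balanced L s z k} = {}" by (auto simp: balanced_def)
  then show ?thesis by (simp only: sets.empty_sets)
qed

text \<open>There are countably many possible balancing vectors, and on the set belonging to each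
  the map is a fixed translation. An arbitrary J covers a constant site as well as
  \<open>lowered_site\<close>.\<close>

lemma lowered_measurable_site:
  "(\<lambda>z. lowered L z (J (balancing L z))) \<in> measurable (vec_space L) (vec_space L)"
proof -
  let ?N = "vec_space L"
  \<comment> \<open>\<open>None\<close> marks the degenerate case, where \<open>lowered\<close>
    ignores its site and the value of \<open>balancing\<close> is irrelevant.\<close>
  define K where "K z = (if \<exists>k. balanced L 1 z k then Some (balancing L z) else None)" for z
  define F where "F k z = (\<lambda>i\<in>{..<L}. case k of None \<Rightarrow> 0
    | Some k \<Rightarrow> z i + of_int (k i) - (if i = J k then 1 else 0))"
    for k :: "(nat \<Rightarrow> int) option" and z :: "nat \<Rightarrow> real"
  define I where "I = insert None (Some ` (Pi\<^sub>E {..<L} (\<lambda>_. UNIV :: int set)))"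
  have I: "countable I" unfolding I_def by (auto intro!: countable_PiE)
  have K_Some: "K z = Some k \<longleftrightarrow> balanced L 1 z k" for z k
    using balancing_eq balanced_balancing by (auto simp: K_def)
  have K_None: "K z = None \<longleftrightarrow> (\<forall>k. \<not> balanced L 1 z k)" for z
    by (auto simp: K_def)
  have dom: "balanced L 1 z k \<Longrightarrow> k \<in> Pi\<^sub>E {..<L} (\<lambda>_. UNIV)" for z k
    by (auto simp: balanced_def PiE_iff)
  have K_sets: "K -` {Some k} \<inter> space ?N \<in> sets ?N" for k
  proof -
    have "K -` {Some k} \<inter> space ?N = {z \<in> space ?N. balanced L 1 z k}"
      using K_Some by auto
    then show ?thesis using balanced_sets by simp
  qed
  have K: "K \<in> measurable ?N (count_space I)"
    unfolding measurable_count_space_eq_countable[OF I]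
  proof (intro conjI ballI)
    show "K \<in> space ?N \<rightarrow> I"
    proof
      fix z
      show "K z \<in> I"
        using K_Some[of z] dom[of z] by (cases "K z") (auto simp: I_def)
    qed
    fix a assume "a \<in> I"
    show "K -` {a} \<inter> space ?N \<in> sets ?N"
    proof (cases a)
      case None
      have "K -` {None} \<inter> space ?N =
          space ?N - (\<Union>k\<in>Pi\<^sub>E {..<L} (\<lambda>_. UNIV). K -` {Some k} \<inter> space ?N)"
        using dom by (auto simp: K_Some K_None; blast)
      also have "\<dots> \<in> sets ?N"
        using K_sets by (intro sets.Diff sets.top sets.countable_UN' countable_PiE) auto
      finally show ?thesis using None by simp
    qed (use K_sets in simp)
  qed
  have F: "F k \<in> measurable ?N ?N" for k
    unfolding F_def
    by (subst (2) vec_space_def, rule measurable_restrict, cases k)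
      (auto intro!: borel_measurable_add borel_measurable_diff component_measurable)
  have "(\<lambda>z. F (K z) z) \<in> measurable ?N ?N"
    by (rule measurable_compose_countable'[OF F K I])
  also have "(\<lambda>z. F (K z) z) = (\<lambda>z. lowered L z (J (balancing L z)))"
    by (auto simp: F_def K_def lowered_def fun_eq_iff)
  finally show ?thesis .
qed

lemma lowered_measurable: "(\<lambda>z. lowered L z j) \<in> measurable (vec_space L) (vec_space L)"
  using lowered_measurable_site[of L "\<lambda>_. j"] .

lemma reduced_z_measurable: "reduced_z L \<in> measurable (vec_space L) (vec_space L)"
  using lowered_measurable_site[of L "\<lambda>k. nat ((\<Sum>i<L. int i * k i) mod int L)"]
  unfolding reduced_z_def lowered_site_def .

lemma lap_vec_measurable_unif:
  "L \<ge> 1 \<Longrightarrow> lap_vec L \<in> measurable (unif_vec L) (vec_space L)"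
  unfolding measurable_cong_sets[OF sets_unif_vec refl] by (rule lap_vec_measurable)

text \<open>Shifting \<open>z i - z j\<close> by an independent continuous random variable does not change its
  law modulo 1.\<close>

lemma AE_lap_vec_diff_notin_Ints:
  assumes L: "L \<ge> 1" and ij: "i < L" "j < L" "i \<noteq> j"
  shows "AE \<alpha> in unif_vec L. lap_vec L \<alpha> i - lap_vec L \<alpha> j \<notin> \<int>"
proof -
  interpret U: prob_space unif by (rule prob_space_unif)
  interpret V: prob_space "unif_vec L" by (rule prob_space_unif_vec)
  interpret P: pair_sigma_finite unif "unif_vec L" ..
  let ?X = "lap_vec L"
  note X = lap_vec_measurable_unif[OF L]
  have [measurable]: "(\<lambda>\<alpha>. ?X \<alpha> i) \<in> borel_measurable (unif_vec L)"
    "(\<lambda>\<alpha>. ?X \<alpha> j) \<in> borel_measurable (unif_vec L)"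
    by (auto intro!: measurable_compose[OF X component_measurable] ij)
  have Z[measurable]: "(\<int> :: real set) \<in> sets borel"
    by (intro borel_closed closed_Ints)
  define F :: "(nat \<Rightarrow> real) \<Rightarrow> ennreal" where "F z = indicator \<int> (z i - z j)" for z
  \<comment> \<open>Adding c at i and subtracting it at j keeps the sum and moves the difference of
    the two entries by 2 c.\<close>
  define y :: "real \<Rightarrow> nat \<Rightarrow> real" where
    "y c l = c * (if l = i then 1 else 0) - c * (if l = j then 1 else 0)" for c l
  have F: "F \<in> borel_measurable (vec_space L)"
    unfolding F_def
    by (intro measurable_compose[OF _ borel_measurable_indicator[OF Z]] borel_measurable_diff component_measurable ij)
  have per: "F (shifted L z (\<lambda>i. of_int (k i))) = F z" for z k
  proof -
    have "z i + of_int (k i) - (z j + of_int (k j)) = (z i - z j) + of_int (k i - k j)" by simp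
    then have "z i + of_int (k i) - (z j + of_int (k j)) \<in> \<int> \<longleftrightarrow> z i - z j \<in> \<int>"
      by (metis Ints_add Ints_diff Ints_of_int add_diff_cancel_right')
    then show ?thesis using ij by (simp add: F_def shifted_def indicator_def)
  qed
  have "(\<integral>\<^sup>+\<alpha>. F (?X \<alpha>) \<partial>unif_vec L) = (\<integral>\<^sup>+c. (\<integral>\<^sup>+\<alpha>. F (?X \<alpha>) \<partial>unif_vec L) \<partial>unif)"
    using U.emeasure_space_1 by simp
  also have "\<dots> = (\<integral>\<^sup>+c. (\<integral>\<^sup>+\<alpha>. F (shifted L (?X \<alpha>) (y c)) \<partial>unif_vec L) \<partial>unif)"
  proof (rule nn_integral_cong, rule nn_integral_lap_vec_shifted[OF L F per, symmetric])
    fix c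
    show "(\<Sum>l<L. y c l) = 0"
      using ij by (simp add: y_def sum_subtractf flip: sum_distrib_left)
  qed
  also have "\<dots> = (\<integral>\<^sup>+c. (\<integral>\<^sup>+\<alpha>. indicator \<int> (?X \<alpha> i - ?X \<alpha> j + 2 * c) \<partial>unif_vec L) \<partial>unif)"
    using ij by (simp add: F_def shifted_def y_def algebra_simps)
  also have "\<dots> = (\<integral>\<^sup>+\<alpha>. (\<integral>\<^sup>+c. indicator \<int> (?X \<alpha> i - ?X \<alpha> j + 2 * c) \<partial>unif) \<partial>unif_vec L)"
    by (rule P.Fubini'[symmetric]) measurable
  also have "\<dots> = (\<integral>\<^sup>+\<alpha>. 0 \<partial>unif_vec L)"
  proof (rule nn_integral_cong)
    fix \<alpha>
    define d where "d = ?X \<alpha> i - ?X \<alpha> j"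
    \<comment> \<open>For fixed disorder, d + 2 c is an integer for only countably many c.\<close>
    have "countable ((\<lambda>n. (of_int n - d) / 2) ` UNIV)" by simp
    then have "AE c in lborel. c \<notin> (\<lambda>n. (of_int n - d) / 2) ` UNIV"
      by (intro AE_not_in countable_imp_null_set_lborel)
    then have "AE c in lborel. d + 2 * c \<notin> \<int>"
      by eventually_elim (force simp: Ints_def field_simps)
    then have "AE c in unif. d + 2 * c \<notin> \<int>"
      unfolding unif_def by (intro AE_uniform_measureI) auto
    then have "(\<integral>\<^sup>+c. indicator \<int> (d + 2 * c) \<partial>unif) = (\<integral>\<^sup>+c. 0 \<partial>unif)"
      by (intro nn_integral_cong_AE) (auto simp: indicator_def)
    then show "(\<integral>\<^sup>+c. indicator \<int> (?X \<alpha> i - ?X \<alpha> j + 2 * c) \<partial>unif) = 0"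
      by (simp add: d_def)
  qed
  finally have "(\<integral>\<^sup>+\<alpha>. F (?X \<alpha>) \<partial>unif_vec L) = 0" by simp
  then have "AE \<alpha> in unif_vec L. F (?X \<alpha>) = 0"
    by (subst (asm) nn_integral_0_iff_AE) (auto intro!: measurable_compose[OF X F])
  then show ?thesis
    by eventually_elim (auto simp: F_def indicator_def split: if_splits)
qed

lemma AE_threshold_z_eq_reduced_z:
  assumes L: "L \<ge> 1"
  shows "AE \<alpha> in unif_vec L. threshold_z L \<alpha> = reduced_z L (lap_vec L \<alpha>)"
proof -
  have "AE \<alpha> in unif_vec L. \<forall>i\<in>{..<L}. \<forall>j\<in>{..<L}. i \<noteq> j \<longrightarrow> lap_vec L \<alpha> i - lap_vec L \<alpha> j \<notin> \<int>"
    using AE_lap_vec_diff_notin_Ints[OF L]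
    by (intro eventually_ball_finite ballI finite_lessThan AE_impI) auto
  then show ?thesis
  proof eventually_elim
    case (elim \<alpha>)
    then show ?case
      by (intro threshold_z_eq_reduced_z[OF L] balanced_ex[OF L]) auto
  qed
qed

text \<open>Translation by each coset representative preserves the integral, and the L translates
  together run over all lowered sites. Thus the lowered site is uniform given the balanced
  entries.\<close>

lemma nn_integral_reduced_z:
  assumes L: "L \<ge> 1" and h: "h \<in> borel_measurable (vec_space L)"
  shows "of_nat L * (\<integral>\<^sup>+\<alpha>. h (reduced_z L (lap_vec L \<alpha>)) \<partial>unif_vec L) =
    (\<integral>\<^sup>+\<alpha>. (\<Sum>j<L. h (lowered L (lap_vec L \<alpha>) j)) \<partial>unif_vec L)"
proof -
  note X = lap_vec_measurable_unif[OF L]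
  have hr: "(\<lambda>z. h (reduced_z L z)) \<in> borel_measurable (vec_space L)"
    by (rule measurable_compose[OF reduced_z_measurable h])
  let ?sh = "\<lambda>s z. shifted L z (\<lambda>i. of_int (transfer s i))"
  have "of_nat L * (\<integral>\<^sup>+\<alpha>. h (reduced_z L (lap_vec L \<alpha>)) \<partial>unif_vec L) =
      (\<Sum>s<L. \<integral>\<^sup>+\<alpha>. h (reduced_z L (lap_vec L \<alpha>)) \<partial>unif_vec L)"
    by simp
  also have "\<dots> = (\<Sum>s<L. \<integral>\<^sup>+\<alpha>. h (reduced_z L (?sh s (lap_vec L \<alpha>))) \<partial>unif_vec L)"
  proof (rule sum.cong)
    fix s assume "s \<in> {..<L}"
    then have "(\<Sum>i<L. real_of_int (transfer s i)) = 0"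
      by (simp add: sum_transfer flip: of_int_sum)
    then show "(\<integral>\<^sup>+\<alpha>. h (reduced_z L (lap_vec L \<alpha>)) \<partial>unif_vec L) =
        (\<integral>\<^sup>+\<alpha>. h (reduced_z L (?sh s (lap_vec L \<alpha>))) \<partial>unif_vec L)"
      by (intro nn_integral_lap_vec_shifted[OF L hr, symmetric]) (simp_all add: reduced_z_shifted)
  qed simp
  also have "\<dots> = (\<integral>\<^sup>+\<alpha>. (\<Sum>s<L. h (reduced_z L (?sh s (lap_vec L \<alpha>)))) \<partial>unif_vec L)"
    by (intro nn_integral_sum[symmetric] measurable_compose[OF _ hr]
        measurable_compose[OF X shifted_measurable_const])
  finally show ?thesis by (simp add: sum_reduced_z_transfer[OF L])
qed

text \<open>Both sides equal the double integral of \<open>G (permuted L \<sigma> (\<Delta>\<alpha>) + \<Delta>\<beta>)\<close> over independent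
  \<open>\<alpha>\<close> and \<open>\<beta>\<close>: integrate first over one variable or over the other.\<close>

lemma nn_integral_permuted_lap_vec:
  assumes L: "L \<ge> 1" and \<sigma>: "\<sigma> permutes {..<L}" and G: "G \<in> borel_measurable (vec_space L)"
    and per: "\<And>z k. z \<in> space (vec_space L) \<Longrightarrow> (\<Sum>i<L. k i) = (0::int) \<Longrightarrow>
      G (shifted L z (\<lambda>i. of_int (k i))) = G z"
  shows "(\<integral>\<^sup>+\<alpha>. G (permuted L \<sigma> (lap_vec L \<alpha>)) \<partial>unif_vec L) =
    (\<integral>\<^sup>+\<alpha>. G (lap_vec L \<alpha>) \<partial>unif_vec L)"
proof -
  interpret V: prob_space "unif_vec L" by (rule prob_space_unif_vec)
  interpret P: pair_sigma_finite "unif_vec L" "unif_vec L" ..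
  let ?V = "unif_vec L" and ?X = "lap_vec L" and ?p = "permuted L \<sigma>"
  note X = lap_vec_measurable_unif[OF L]
  note pm = permuted_measurable[OF \<sigma>]
  have sumX: "(\<Sum>i<L. ?X \<alpha> i) = 0" for \<alpha>
    using sum_lap[OF L, of \<alpha>] by (simp add: lap_vec_def)
  have permuted_space: "?p z \<in> space (vec_space L)" for z
    by (simp add: vec_space_def space_PiM permuted_def)
  have "(\<integral>\<^sup>+\<alpha>. G (?X \<alpha>) \<partial>?V) = (\<integral>\<^sup>+\<beta>. (\<integral>\<^sup>+\<alpha>. G (?X \<alpha>) \<partial>?V) \<partial>?V)"
    using V.emeasure_space_1 by simp
  also have "\<dots> = (\<integral>\<^sup>+\<beta>. (\<integral>\<^sup>+\<alpha>. G (shifted L (?X \<alpha>) (?p (?X \<beta>))) \<partial>?V) \<partial>?V)"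
    by (intro nn_integral_cong nn_integral_lap_vec_shifted[OF L G, symmetric])
      (auto simp: per lap_lattice_def sum_permuted[OF \<sigma>] sumX)
  also have "\<dots> = (\<integral>\<^sup>+\<alpha>. (\<integral>\<^sup>+\<beta>. G (shifted L (?X \<alpha>) (?p (?X \<beta>))) \<partial>?V) \<partial>?V)"
  proof (rule P.Fubini')
    have "(\<lambda>w. ?X (fst w)) \<in> measurable (?V \<Otimes>\<^sub>M ?V) (vec_space L)"
      "(\<lambda>w. ?p (?X (snd w))) \<in> measurable (?V \<Otimes>\<^sub>M ?V) (vec_space L)"
      by (auto intro!: measurable_compose[OF _ pm] measurable_compose[OF _ X])
    then show "(\<lambda>(\<alpha>, \<beta>). G (shifted L (?X \<alpha>) (?p (?X \<beta>)))) \<in> borel_measurable (?V \<Otimes>\<^sub>M ?V)"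
      unfolding split_beta by (intro measurable_compose[OF _ G] shifted_measurable)
  qed
  also have "\<dots> = (\<integral>\<^sup>+\<alpha>. (\<integral>\<^sup>+\<beta>. G (?p (?X \<beta>)) \<partial>?V) \<partial>?V)"
  proof (rule nn_integral_cong)
    fix \<alpha>
    \<comment> \<open>With the first variable fixed, its Laplacian is pulled through the permutation
      and becomes a translation inside it.\<close>
    let ?y = "permuted L (inv \<sigma>) (?X \<alpha>)"
    have eq: "shifted L (?X \<alpha>) (?p z) = ?p (shifted L z ?y)" for z
    proof -
      have "?y (\<sigma> i) = ?X \<alpha> i" if "i < L" for i
        using that by (simp add: permuted_def permutes_less[OF \<sigma>] permutes_inverses[OF \<sigma>])
      then show ?thesis
        using permutes_less[OF \<sigma>] by (auto simp: permuted_def shifted_def fun_eq_iff)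
    qed
    have Gp: "(\<lambda>z. G (?p z)) \<in> borel_measurable (vec_space L)"
      by (rule measurable_compose[OF pm G])
    have "(\<integral>\<^sup>+\<beta>. G (?p (shifted L (?X \<beta>) ?y)) \<partial>?V) = (\<integral>\<^sup>+\<beta>. G (?p (?X \<beta>)) \<partial>?V)"
    proof (rule nn_integral_lap_vec_shifted[OF L Gp])
      show "(\<Sum>i<L. ?y i) = 0"
        by (simp only: sum_permuted[OF permutes_inv[OF \<sigma>]] sumX)
      \<comment> \<open>A permuted lattice vector may leave the lattice but still sums to zero;
        hence G is assumed invariant under all sum-zero integer translations.\<close>
      fix z and k :: "nat \<Rightarrow> int" assume "k \<in> lap_lattice L"
      then have "(\<Sum>i<L. permuted L \<sigma> k i) = 0"
        by (simp add: sum_permuted[OF \<sigma>] lap_lattice_def)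
      moreover have "?p (shifted L z (\<lambda>i. of_int (k i))) =
          shifted L (?p z) (\<lambda>i. of_int (permuted L \<sigma> k i))"
        using permutes_less[OF \<sigma>] by (auto simp: permuted_def shifted_def fun_eq_iff)
      ultimately show "G (?p (shifted L z (\<lambda>i. of_int (k i)))) = G (?p z)"
        using per[OF permuted_space] by simp
    qed
    then show "(\<integral>\<^sup>+\<beta>. G (shifted L (?X \<alpha>) (?p (?X \<beta>))) \<partial>?V) = (\<integral>\<^sup>+\<beta>. G (?p (?X \<beta>)) \<partial>?V)"
      by (simp only: eq)
  qed
  also have "\<dots> = (\<integral>\<^sup>+\<beta>. G (?p (?X \<beta>)) \<partial>?V)"
    using V.emeasure_space_1 by simp
  finally show ?thesis by simp
qed

text \<open>Summing over the lowered site gives a function to which both equivariance and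
  \<open>nn_integral_permuted_lap_vec\<close> apply; the finite nonzero factor L is cancelled at the
  end.\<close>

lemma nn_integral_permuted_reduced_z:
  assumes L: "L \<ge> 1" and \<sigma>: "\<sigma> permutes {..<L}" and h: "h \<in> borel_measurable (vec_space L)"
  shows "(\<integral>\<^sup>+\<alpha>. h (permuted L \<sigma> (reduced_z L (lap_vec L \<alpha>))) \<partial>unif_vec L) =
    (\<integral>\<^sup>+\<alpha>. h (reduced_z L (lap_vec L \<alpha>)) \<partial>unif_vec L)"
proof -
  have "of_nat L * (\<integral>\<^sup>+\<alpha>. h (permuted L \<sigma> (reduced_z L (lap_vec L \<alpha>))) \<partial>unif_vec L) =
      (\<integral>\<^sup>+\<alpha>. (\<Sum>j<L. h (permuted L \<sigma> (lowered L (lap_vec L \<alpha>) j))) \<partial>unif_vec L)"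
    by (rule nn_integral_reduced_z[OF L measurable_compose[OF permuted_measurable[OF \<sigma>] h]])
  also have "\<dots> = (\<integral>\<^sup>+\<alpha>. (\<Sum>j<L. h (lowered L (permuted L \<sigma> (lap_vec L \<alpha>)) j)) \<partial>unif_vec L)"
    by (simp only: sum_lowered_permuted[OF \<sigma>, of h])
  also have "\<dots> = (\<integral>\<^sup>+\<alpha>. (\<Sum>j<L. h (lowered L (lap_vec L \<alpha>) j)) \<partial>unif_vec L)"
    by (rule nn_integral_permuted_lap_vec[OF L \<sigma>])
      (auto simp: lowered_shifted intro!: borel_measurable_sum measurable_compose[OF lowered_measurable h])
  also have "\<dots> = of_nat L * (\<integral>\<^sup>+\<alpha>. h (reduced_z L (lap_vec L \<alpha>)) \<partial>unif_vec L)"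
    by (rule nn_integral_reduced_z[OF L h, symmetric])
  finally show ?thesis
    using L by (subst (asm) ennreal_mult_cancel_left) (auto simp: ennreal_of_nat_eq_real_of_nat)
qed

section \<open>Passage to the completed disorder\<close>

lemma disorder_eq: "disorder L = completion (unif_vec L)"
  by (simp only: disorder_def unif_def)

text \<open>The \<open>SOME\<close> in \<open>threshold_z\<close> is controlled only off a null set,
  where the map equals the measurable \<open>reduced_z\<close> of the Laplacian; completeness of the
  measure bridges the gap.\<close>

lemma threshold_z_measurable:
  assumes L: "L \<ge> 1"
  shows "threshold_z L \<in> measurable (disorder L) (vec_space L)"
  unfolding disorder_eq
proof (rule measurableI)
  let ?C = "completion (unif_vec L)"
  have g: "(\<lambda>\<alpha>. reduced_z L (lap_vec L \<alpha>)) \<in> measurable ?C (vec_space L)"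
    by (intro measurable_completion measurable_compose[OF lap_vec_measurable_unif[OF L] reduced_z_measurable])
  show "threshold_z L \<alpha> \<in> space (vec_space L)" for \<alpha>
    by (simp add: vec_space_def space_PiM threshold_z_def)
  fix B assume B: "B \<in> sets (vec_space L)"
  show "threshold_z L -` B \<inter> space ?C \<in> sets ?C"
  proof (rule completion.in_sets_AE)
    show "(\<lambda>\<alpha>. reduced_z L (lap_vec L \<alpha>)) -` B \<inter> space ?C \<in> sets ?C"
      using measurable_sets[OF g B] .
    show "AE \<alpha> in ?C. \<alpha> \<in> (\<lambda>\<alpha>. reduced_z L (lap_vec L \<alpha>)) -` B \<inter> space ?C \<longleftrightarrow>
        \<alpha> \<in> threshold_z L -` B \<inter> space ?C"
      using AE_completion[OF AE_threshold_z_eq_reduced_z[OF L]] by eventually_elim simp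
  qed simp
qed

theorem theorem2:
  fixes L :: nat
  assumes "L \<ge> 1"
  shows "threshold_z L \<in> measurable (disorder L) (vec_space L) \<and>
    (\<forall>\<sigma>. \<sigma> permutes {..<L} \<longrightarrow>
       distr (disorder L) (vec_space L) (\<lambda>\<alpha>. \<lambda>i\<in>{..<L}. threshold_z L \<alpha> (\<sigma> i))
       = distr (disorder L) (vec_space L) (threshold_z L))"
proof (intro conjI allI impI)
  show T: "threshold_z L \<in> measurable (disorder L) (vec_space L)"
    by (rule threshold_z_measurable[OF assms])
  fix \<sigma> assume \<sigma>: "\<sigma> permutes {..<L}"
  let ?N = "vec_space L" and ?r = "\<lambda>\<alpha>. reduced_z L (lap_vec L \<alpha>)"
  have pT: "(\<lambda>\<alpha>. permuted L \<sigma> (threshold_z L \<alpha>)) \<in> measurable (disorder L) ?N"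
    by (rule measurable_compose[OF T permuted_measurable[OF \<sigma>]])
  \<comment> \<open>Completion does not change nonnegative integrals, so laws under the disorder can
    be computed over the plain product measure, where almost everywhere equality replaces
    \<open>threshold_z\<close>.\<close>
  have emeasure_eq: "emeasure (distr (disorder L) ?N f) B = (\<integral>\<^sup>+\<alpha>. indicator B (f \<alpha>) \<partial>unif_vec L)"
    if "f \<in> measurable (disorder L) ?N" "B \<in> sets ?N" for f B
  proof -
    have "emeasure (distr (disorder L) ?N f) B = (\<integral>\<^sup>+z. indicator B z \<partial>distr (disorder L) ?N f)"
      using that by simp
    also have "\<dots> = (\<integral>\<^sup>+\<alpha>. indicator B (f \<alpha>) \<partial>disorder L)"
      using that by (intro nn_integral_distr) auto
    finally show ?thesis by (simp only: disorder_eq nn_integral_completion)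
  qed
  have "distr (disorder L) ?N (\<lambda>\<alpha>. permuted L \<sigma> (threshold_z L \<alpha>)) =
      distr (disorder L) ?N (threshold_z L)"
  proof (rule measure_eqI)
    fix B assume "B \<in> sets (distr (disorder L) ?N (\<lambda>\<alpha>. permuted L \<sigma> (threshold_z L \<alpha>)))"
    then have B: "B \<in> sets ?N" by simp
    note ae = AE_threshold_z_eq_reduced_z[OF assms]
    have "emeasure (distr (disorder L) ?N (\<lambda>\<alpha>. permuted L \<sigma> (threshold_z L \<alpha>))) B =
        (\<integral>\<^sup>+\<alpha>. indicator B (permuted L \<sigma> (threshold_z L \<alpha>)) \<partial>unif_vec L)"
      by (rule emeasure_eq[OF pT B])
    also have "\<dots> = (\<integral>\<^sup>+\<alpha>. indicator B (permuted L \<sigma> (?r \<alpha>)) \<partial>unif_vec L)"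
      using ae by (intro nn_integral_cong_AE) (auto elim: eventually_mono)
    also have "\<dots> = (\<integral>\<^sup>+\<alpha>. indicator B (?r \<alpha>) \<partial>unif_vec L)"
      using B by (intro nn_integral_permuted_reduced_z[OF assms \<sigma>]) auto
    also have "\<dots> = (\<integral>\<^sup>+\<alpha>. indicator B (threshold_z L \<alpha>) \<partial>unif_vec L)"
      using ae by (intro nn_integral_cong_AE) (auto elim: eventually_mono)
    also have "\<dots> = emeasure (distr (disorder L) ?N (threshold_z L)) B"
      by (rule emeasure_eq[OF T B, symmetric])
    finally show "emeasure (distr (disorder L) ?N (\<lambda>\<alpha>. permuted L \<sigma> (threshold_z L \<alpha>))) B =
        emeasure (distr (disorder L) ?N (threshold_z L)) B" .
  qed simp
  then show "distr (disorder L) ?N (\<lambda>\<alpha>. \<lambda>i\<in>{..<L}. threshold_z L \<alpha> (\<sigma> i)) =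
      distr (disorder L) ?N (threshold_z L)"
    by (simp only: permuted_def)
qed

end
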